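(* Let $n\ge1$ and $t,y\ge0$ be integers with $t\equiv y\pmod2$. Then $$Z^{(n)}_t(y;\kappa)=\Big(\prod_{i=0}^{n-1}(t+2i)!\,i!\Big)\Big(\prod_{i=0}^{n-2}\frac{(y+n+i-1)!}{(y+2i)!\,\left(\frac{t+y}2+n+i\right)!\,\left(\frac{t-y}2+i+1\right)!}\Big)$$ $$\times\sum_{h=0}^{(t-y)/2}\binom{n+h-1}{n-1}\frac{(y+2n+2h-1)\,(y+2n+h-2)!}{(y+n+h-1)!\,\left(\frac{t+y}2+2n+h-1\right)!\,\left(\frac{t-y}2-h\right)!}\,\kappa(\kappa-1)^h .$$
   Context: A walk is a lattice path in $\mathbb Z^2$ with steps $(1,1)$ and $(1,-1)$ never going below the $x$-axis. A family of walks is vicious if no two of its walks share a lattice point. A contact is a lattice point on the $x$-axis lying on one of the walks (starting and end points included); $c(\mathbf P)$ is the total number of contacts of a family $\mathbf P$. $Z^{(n)}_t(y;\kappa)=\sum_{\mathbf P}\kappa^{c(\mathbf P)}$, summed over vicious families $(P_1,\dots,P_n)$ with $P_i$ running from $(0,2i-2)$ to $(t,y+2i-2)$. Convention: $1/m!=0$ for negative integers $m$. *)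

theory Defs
  imports Complex_Main "HOL-Library.FuncSet" "HOL-Library.Product_Plus"
begin

text \<open>A lattice path is represented by the list of the lattice points it visits, in order.\<close>

definition is_walk :: "(int \<times> int) list \<Rightarrow> bool" where
  "is_walk w \<longleftrightarrow> w \<noteq> [] \<and> successively (\<lambda>p q. q - p \<in> {(1, 1), (1, -1)}) w
     \<and> (\<forall>p\<in>set w. snd p \<ge> 0)"

definition walks :: "int \<times> int \<Rightarrow> int \<times> int \<Rightarrow> (int \<times> int) list set" where
  "walks a b = {w. is_walk w \<and> hd w = a \<and> last w = b}"

definition vicious :: "'i set \<Rightarrow> ('i \<Rightarrow> (int \<times> int) list) \<Rightarrow> bool" where
  "vicious I P \<longleftrightarrow> (\<forall>i\<in>I. \<forall>j\<in>I. i \<noteq> j \<longrightarrow> set (P i) \<inter> set (P j) = {})"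

definition contacts :: "'i set \<Rightarrow> ('i \<Rightarrow> (int \<times> int) list) \<Rightarrow> nat" where
  "contacts I P = card {p. snd p = 0 \<and> (\<exists>i\<in>I. p \<in> set (P i))}"

definition families :: "nat \<Rightarrow> nat \<Rightarrow> nat \<Rightarrow> (nat \<Rightarrow> (int \<times> int) list) set" where
  "families n t y =
     {P \<in> (\<Pi>\<^sub>E i\<in>{1..n}. walks (0, 2 * int i - 2) (int t, int y + 2 * int i - 2)).
        vicious {1..n} P}"

definition Z :: "nat \<Rightarrow> nat \<Rightarrow> nat \<Rightarrow> 'a::comm_semiring_1 \<Rightarrow> 'a" where
  "Z n t y \<kappa> = (\<Sum>P\<in>families n t y. \<kappa> ^ contacts {1..n} P)"

definition inv_fact :: "int \<Rightarrow> 'a::field_char_0" where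
  "inv_fact m = (if m < 0 then 0 else 1 / fact (nat m))"

text \<open>The sum defining \<^const>\<open>Z\<close> ranges over a finite set, so it never takes the
  default value of sums over infinite sets.\<close>

lemma is_walk_bounds:
  assumes "is_walk w"
  shows "int (length w) = fst (last w) - fst (hd w) + 1
    \<and> set w \<subseteq> {fst (hd w)..fst (last w)} \<times> {0..snd (hd w) + fst (last w) - fst (hd w)}"
  using assms
proof (induction w)
  case Nil
  then show ?case by (simp add: is_walk_def)
next
  case (Cons p w)
  show ?case
  proof (cases w)
    case Nil
    with Cons.prems show ?thesis by (cases p) (auto simp: is_walk_def)
  next
    case (Cons q v)
    have w: "is_walk w" and st: "q - p = (1, 1) \<or> q - p = (1, -1)" and p0: "snd p \<ge> 0"
      using Cons.prems Cons by (auto simp: is_walk_def)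
    have hq: "hd w = q" and l: "last (p # w) = last w" using Cons by auto
    note IH = Cons.IH[OF w, unfolded hq]
    have q: "fst q = fst p + 1" "snd q \<le> snd p + 1"
      using st by (auto simp: prod_eq_iff)
    have ge: "fst (last w) \<ge> fst q"
      using IH Cons by (auto simp: mem_Times_iff)
    have "set w \<subseteq> {fst p..fst (last w)} \<times> {0..snd p + fst (last w) - fst p}"
      using IH q by (fastforce simp: mem_Times_iff)
    moreover have "p \<in> {fst p..fst (last w)} \<times> {0..snd p + fst (last w) - fst p}"
      using ge q p0 by (auto simp: mem_Times_iff)
    ultimately show ?thesis using IH q by (simp add: l del: last.simps)
  qed
qed

lemma finite_walks: "finite (walks a b)"
proof (rule finite_subset)
  let ?S = "{fst a..fst b} \<times> {0..snd a + fst b - fst a}"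
  show "walks a b \<subseteq> {w. set w \<subseteq> ?S \<and> length w = nat (fst b - fst a + 1)}"
    using is_walk_bounds by (fastforce simp: walks_def)
  show "finite {w. set w \<subseteq> ?S \<and> length w = nat (fst b - fst a + 1)}"
    by (intro finite_lists_length_eq) auto
qed

lemma finite_families: "finite (families n t y)"
proof (rule finite_subset)
  show "families n t y \<subseteq>
      (\<Pi>\<^sub>E i\<in>{1..n}. walks (0, 2 * int i - 2) (int t, int y + 2 * int i - 2))"
    by (auto simp: families_def)
qed (simp add: finite_PiE finite_walks)

end

theory Submission
  imports Defs "Jordan_Normal_Form.Determinant"
begin

text \<open>Write \<open>b(T, z)\<close> for the ballot numbers and let
  \<open>A(T, z) = \<Sum>h. (\<kappa> - 1)\<^sup>h b(T, z + 2h)\<close>. Then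
  \<open>A(T + 1, z) = A(T, z - 1) + A(T, z + 1)\<close> for \<open>z > 0\<close> and \<open>A(T + 1, 0) = \<kappa> A(T, 1)\<close>.
  Hence \<open>\<kappa> det (A(t + 2j, y\<^sub>i))\<close>, with \<open>0 \<le> i, j < n\<close>, satisfies the same recurrence in \<open>t\<close>
  as the weighted number of vicious families ending at heights \<open>y\<^sub>0 < \<dots> < y\<^bsub>n-1\<^esub>\<close>: removing
  the last step of every walk amounts to multilinearity of the determinant, and the determinant
  vanishes when two heights coincide. The extra \<open>2j\<close> in the time argument encodes the packed
  starting points, for which the matrix at \<open>t = 0\<close> is triangular.

  At the heights \<open>y\<^sub>i = y + 2i\<close> the relation \<open>A(T, z) = b(T, z) + (\<kappa> - 1) A(T, z + 2)\<close> allows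
  row operations that turn every row but the last into ballot numbers, which leaves a single sum
  over \<open>h\<close>. A determinant of ballot numbers is a product: up to row and column factors its
  entries are \<open>\<Prod>k>j. c\<^sub>k - (z\<^sub>i + 1)\<^sup>2 / 4\<close>, so it is a Vandermonde determinant.\<close>

section \<open>One step of a vicious family\<close>

text \<open>\<open>fst a \<le> t\<close> excludes the one-point walk, so there is a last step to
  remove. The offset \<open>e\<close> points back to the previous height: \<open>e = 1\<close>
  stands for a final down step.\<close>

lemma walks_snoc_iff:
  assumes "fst a \<le> t" "z \<ge> 0"
  shows "w \<in> walks a (t + 1, z) \<longleftrightarrow>
    (\<exists>e\<in>{1, -1}. \<exists>v\<in>walks a (t, z + e). w = v @ [(t + 1, z)])"
proof
  assume w: "w \<in> walks a (t + 1, z)"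
  define v where "v = butlast w"
  have w_eq: "w = v @ [(t + 1, z)]"
    using w append_butlast_last_id[of w] by (auto simp: v_def walks_def is_walk_def)
  have "v \<noteq> []"
    using w w_eq assms(1) by (auto simp: walks_def)
  then have "is_walk v" "hd v = a" and st: "(t + 1, z) - last v \<in> {(1, 1), (1, -1)}"
    using w unfolding w_eq walks_def is_walk_def by (auto simp: successively_append_iff)
  moreover have "last v = (t, z + (snd (last v) - z))" "snd (last v) - z \<in> {1, -1}"
    using st by (cases "last v"; auto)+
  ultimately show "\<exists>e\<in>{1, -1}. \<exists>v\<in>walks a (t, z + e). w = v @ [(t + 1, z)]"
    using w_eq unfolding walks_def by blast
next
  assume "\<exists>e\<in>{1, -1}. \<exists>v\<in>walks a (t, z + e). w = v @ [(t + 1, z)]"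
  then show "w \<in> walks a (t + 1, z)"
    using assms(2) by (auto simp: walks_def is_walk_def successively_append_iff)
qed

lemma fst_le_of_mem_walk: "w \<in> walks a (t, z) \<Longrightarrow> p \<in> set w \<Longrightarrow> fst p \<le> t"
  using is_walk_bounds[of w] by (auto simp: walks_def)

text \<open>Starting points and end heights are arbitrary, so that deleting the last step of every
  walk stays within the class.\<close>

definition families_to ::
  "'i set \<Rightarrow> ('i \<Rightarrow> int \<times> int) \<Rightarrow> int \<Rightarrow> ('i \<Rightarrow> int) \<Rightarrow> ('i \<Rightarrow> (int \<times> int) list) set" where
  "families_to I a t Y = {P \<in> (\<Pi>\<^sub>E i\<in>I. walks (a i) (t, Y i)). vicious I P}"

definition partition_fun ::
  "'i set \<Rightarrow> ('i \<Rightarrow> int \<times> int) \<Rightarrow> int \<Rightarrow> ('i \<Rightarrow> int) \<Rightarrow> 'a::comm_semiring_1 \<Rightarrow> 'a" where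
  "partition_fun I a t Y \<kappa> = (\<Sum>P\<in>families_to I a t Y. \<kappa> ^ contacts I P)"

lemma finite_families_to: "finite I \<Longrightarrow> finite (families_to I a t Y)"
  by (rule finite_subset[of _ "\<Pi>\<^sub>E i\<in>I. walks (a i) (t, Y i)"])
    (auto simp: families_to_def finite_PiE finite_walks)

lemma families_to_not_inj: "\<not> inj_on Y I \<Longrightarrow> families_to I a t Y = {}"
proof (rule ccontr)
  assume "\<not> inj_on Y I" "families_to I a t Y \<noteq> {}"
  then obtain P i j where P: "P \<in> families_to I a t Y"
    and ij: "i \<in> I" "j \<in> I" "i \<noteq> j" "Y i = Y j"
    by (auto simp: inj_on_def)
  from P ij have "P i \<noteq> []" "P j \<noteq> []" "last (P i) = last (P j)" "set (P i) \<inter> set (P j) = {}"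
    by (auto simp: families_to_def vicious_def walks_def is_walk_def PiE_def Pi_def)
  then show False by (metis disjoint_iff last_in_set)
qed

lemma families_to_negative: "i \<in> I \<Longrightarrow> Y i < 0 \<Longrightarrow> families_to I a t Y = {}"
  by (fastforce simp: families_to_def walks_def is_walk_def PiE_def Pi_def
      dest: last_in_set)

text \<open>The appended points have time \<open>t + 1\<close>, later than every point of the walks
  in \<open>Q\<close>, and injectivity of \<open>Y\<close> keeps them apart from each other.\<close>

lemma vicious_snoc:
  assumes "\<And>i. i \<in> I \<Longrightarrow> Q i \<in> walks (a i) (t, X i)" "inj_on Y I"
  shows "vicious I (\<lambda>i\<in>I. Q i @ [(t + 1, Y i)]) \<longleftrightarrow> vicious I Q"
proof -
  have new: "(t + 1, Y j) \<notin> set (Q i)" if "i \<in> I" for i j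
    using fst_le_of_mem_walk[OF assms(1)[OF that], of "(t + 1, Y j)"] by auto
  have "set (Q i @ [(t + 1, Y i)]) \<inter> set (Q j @ [(t + 1, Y j)]) = set (Q i) \<inter> set (Q j)"
    if "i \<in> I" "j \<in> I" "i \<noteq> j" for i j
    using new that inj_onD[OF assms(2), of i j] by auto
  then show ?thesis by (simp add: vicious_def)
qed

lemma contacts_snoc:
  assumes "\<And>i. i \<in> I \<Longrightarrow> Q i \<in> walks (a i) (t, X i)" "inj_on Y I" "finite I"
  shows "contacts I (\<lambda>i\<in>I. Q i @ [(t + 1, Y i)]) = contacts I Q + card {i\<in>I. Y i = 0}"
proof -
  let ?A = "{p. snd p = 0 \<and> (\<exists>i\<in>I. p \<in> set (Q i))}"
  let ?B = "(\<lambda>i. (t + 1, Y i)) ` {i\<in>I. Y i = 0}"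
  have "{p. snd p = 0 \<and> (\<exists>i\<in>I. p \<in> set ((\<lambda>i\<in>I. Q i @ [(t + 1, Y i)]) i))} = ?A \<union> ?B"
    by auto
  moreover have "finite ?A"
    by (rule finite_subset[of _ "\<Union>i\<in>I. set (Q i)"]) (use assms(3) in auto)
  moreover have "?A \<inter> ?B = {}"
    using fst_le_of_mem_walk[OF assms(1)] by fastforce
  moreover have "card ?B = card {i\<in>I. Y i = 0}"
    using assms(2) by (intro card_image) (auto simp: inj_on_def)
  ultimately show ?thesis
    using assms(3) by (simp add: contacts_def card_Un_disjoint)
qed

text \<open>A family corresponds to its truncated family together with the vector \<open>e\<close>
  of backward steps. All \<open>e\<close> may be summed over, since colliding or negative heights
  admit no family.\<close>

lemma partition_fun_step:
  assumes I: "finite I" and inj: "inj_on Y I"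
    and Y: "\<And>i. i \<in> I \<Longrightarrow> Y i \<ge> 0" and a: "\<And>i. i \<in> I \<Longrightarrow> fst (a i) \<le> t"
  shows "partition_fun I a (t + 1) Y \<kappa> = \<kappa> ^ card {i\<in>I. Y i = 0} *
    (\<Sum>e\<in>(\<Pi>\<^sub>E i\<in>I. {1, -1}). partition_fun I a t (\<lambda>i. Y i + e i) \<kappa>)"
proof -
  let ?E = "\<Pi>\<^sub>E i\<in>I. {1, -1 :: int}"
  let ?S = "SIGMA e:?E. families_to I a t (\<lambda>i. Y i + e i)"
  \<comment> \<open>The backward steps are read off from the penultimate points; restricting to
    \<open>I\<close> makes both components extensional, so that \<open>?down\<close> and
    \<open>?up\<close> are mutually inverse.\<close>
  let ?down = "\<lambda>P. (\<lambda>i\<in>I. snd (last (butlast (P i))) - Y i, \<lambda>i\<in>I. butlast (P i))"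
  let ?up = "\<lambda>(e, Q). \<lambda>i\<in>I. Q i @ [(t + 1, Y i)]"
  have "partition_fun I a (t + 1) Y \<kappa>
      = (\<Sum>(e, Q)\<in>?S. \<kappa> ^ card {i\<in>I. Y i = 0} * \<kappa> ^ contacts I Q)"
    unfolding partition_fun_def
  proof (rule sum.reindex_bij_witness[of _ ?up ?down])
    fix P assume P: "P \<in> families_to I a (t + 1) Y"
    then have ext: "P \<in> extensional I" and "vicious I P"
      by (auto simp: families_to_def PiE_def)
    have ex: "\<exists>e v. e \<in> {1, -1} \<and> v \<in> walks (a i) (t, Y i + e) \<and> P i = v @ [(t + 1, Y i)]"
      if "i \<in> I" for i
      using walks_snoc_iff[OF a[OF that] Y[OF that], of "P i"] P that
      by (auto simp: families_to_def PiE_def Pi_def)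
    then obtain e v where ev: "\<And>i. i \<in> I \<Longrightarrow>
        e i \<in> {1, -1} \<and> v i \<in> walks (a i) (t, Y i + e i) \<and> P i = v i @ [(t + 1, Y i)]"
      by metis
    then have down: "?down P = (restrict e I, restrict v I)"
      by (fastforce simp: walks_def intro!: restrict_ext)
    show up_down: "?up (?down P) = P"
      unfolding down using ev ext by (auto simp: fun_eq_iff restrict_def extensional_def)
    have P_eq: "P = (\<lambda>i\<in>I. restrict v I i @ [(t + 1, Y i)])"
      using up_down unfolding down by simp
    have vw: "restrict v I i \<in> walks (a i) (t, Y i + restrict e I i)" if "i \<in> I" for i
      using ev[OF that] that by auto
    have "vicious I (restrict v I)"
      using \<open>vicious I P\<close> unfolding P_eq by (subst (asm) vicious_snoc[OF vw inj])
    then show "?down P \<in> ?S"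
      unfolding down using ev vw by (auto simp: families_to_def)
    show "(case ?down P of (e, Q) \<Rightarrow> \<kappa> ^ card {i\<in>I. Y i = 0} * \<kappa> ^ contacts I Q)
        = \<kappa> ^ contacts I P"
    proof -
      have "contacts I P = contacts I (restrict v I) + card {i\<in>I. Y i = 0}"
        by (subst P_eq, rule contacts_snoc[OF vw inj I])
      then show ?thesis by (simp add: down power_add mult.commute)
    qed
  next
    fix eQ assume "eQ \<in> ?S"
    then obtain e Q where eQ: "eQ = (e, Q)" "e \<in> ?E" "Q \<in> families_to I a t (\<lambda>i. Y i + e i)"
      by auto
    then have Qw: "\<And>i. i \<in> I \<Longrightarrow> Q i \<in> walks (a i) (t, Y i + e i)" and "vicious I Q"
      and ext: "e \<in> extensional I" "Q \<in> extensional I"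
      by (auto simp: families_to_def PiE_def Pi_def)
    have "snd (last (Q i)) = Y i + e i" if "i \<in> I" for i
      using Qw[OF that] by (auto simp: walks_def)
    then show "?down (?up eQ) = eQ"
      using ext unfolding eQ(1) by (auto simp: fun_eq_iff restrict_def extensional_def)
    have "Q i @ [(t + 1, Y i)] \<in> walks (a i) (t + 1, Y i)" if "i \<in> I" for i
      using Qw[OF that] eQ(2) that by (subst walks_snoc_iff[OF a[OF that] Y[OF that]]) blast
    then show "?up eQ \<in> families_to I a (t + 1) Y"
      unfolding eQ(1) families_to_def using vicious_snoc[OF Qw inj] \<open>vicious I Q\<close> by auto
  qed
  also have "\<dots> = \<kappa> ^ card {i\<in>I. Y i = 0} *
      (\<Sum>e\<in>?E. partition_fun I a t (\<lambda>i. Y i + e i) \<kappa>)"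
    unfolding partition_fun_def
    by (subst sum.Sigma[symmetric])
      (simp_all add: finite_PiE I finite_families_to sum_distrib_left)
  finally show ?thesis .
qed

section \<open>Determinants\<close>

text \<open>Multilinearity in all rows at once: in the Leibniz formula each product of sums expands
  over choice functions \<open>e\<close>. The bijection \<open>b\<close> lets rows be labelled by
  walks, which are numbered from 1.\<close>

lemma det_sum_rows:
  fixes f :: "'i \<Rightarrow> 'b \<Rightarrow> nat \<Rightarrow> 'a::comm_ring_1"
  assumes b: "bij_betw b {..<n} I" and K: "\<And>i. i \<in> I \<Longrightarrow> finite (K i)"
  shows "det (mat n n (\<lambda>(i, j). c (b i) * (\<Sum>k\<in>K (b i). f (b i) k j))) =
    (\<Prod>i\<in>I. c i) * (\<Sum>e\<in>(\<Pi>\<^sub>E i\<in>I. K i). det (mat n n (\<lambda>(i, j). f (b i) (e (b i)) j)))"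
proof -
  let ?P = "{p. p permutes {0..<n}}"
  let ?r = "inv_into {..<n} b"
  have I: "finite I" using bij_betw_finite[OF b] by simp
  have det: "det (mat n n (\<lambda>(i, j). g (b i) j)) = (\<Sum>p\<in>?P. signof p * (\<Prod>i\<in>I. g i (p (?r i))))"
    for g :: "'i \<Rightarrow> nat \<Rightarrow> 'a"
  proof -
    have "(\<Prod>i = 0..<n. mat n n (\<lambda>(i, j). g (b i) j) $$ (i, p i)) = (\<Prod>i\<in>I. g i (p (?r i)))"
      if "p permutes {0..<n}" for p
    proof -
      have "(\<Prod>i\<in>I. g i (p (?r i))) = (\<Prod>i<n. g (b i) (p (?r (b i))))"
        by (rule prod.reindex_bij_betw[OF b, symmetric])
      also have "\<dots> = (\<Prod>i<n. g (b i) (p i))"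
        using b by (intro prod.cong) (auto simp: bij_betw_def)
      also have "\<dots> = (\<Prod>i = 0..<n. mat n n (\<lambda>(i, j). g (b i) j) $$ (i, p i))"
        using permutes_in_image[OF that] by (auto simp: atLeast0LessThan intro!: prod.cong)
      finally show ?thesis ..
    qed
    then show ?thesis by (subst det_def'[of _ n]) (auto intro!: sum.cong)
  qed
  have "det (mat n n (\<lambda>(i, j). c (b i) * (\<Sum>k\<in>K (b i). f (b i) k j)))
      = (\<Sum>p\<in>?P. signof p * (\<Prod>i\<in>I. c i * (\<Sum>k\<in>K i. f i k (p (?r i)))))"
    by (rule det)
  also have "\<dots> = (\<Sum>p\<in>?P. \<Sum>e\<in>(\<Pi>\<^sub>E i\<in>I. K i).
      (\<Prod>i\<in>I. c i) * (signof p * (\<Prod>i\<in>I. f i (e i) (p (?r i)))))"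
    using K by (intro sum.cong refl)
      (simp add: prod.distrib prod_sum_PiE[OF I] sum_distrib_left ac_simps)
  also have "\<dots> = (\<Prod>i\<in>I. c i) * (\<Sum>e\<in>(\<Pi>\<^sub>E i\<in>I. K i).
      \<Sum>p\<in>?P. signof p * (\<Prod>i\<in>I. f i (e i) (p (?r i))))"
    by (subst sum.swap) (simp add: sum_distrib_left)
  also have "\<dots> = (\<Prod>i\<in>I. c i) *
      (\<Sum>e\<in>(\<Pi>\<^sub>E i\<in>I. K i). det (mat n n (\<lambda>(i, j). f (b i) (e (b i)) j)))"
    by (simp add: det[of "\<lambda>i. f i (e i)" for e])
  finally show ?thesis .
qed

lemma det_zero_row:
  assumes "k < n" "\<And>j. j < n \<Longrightarrow> f k j = 0"
  shows "det (mat n n (\<lambda>(i, j). f i j) :: 'a::comm_ring_1 mat) = 0"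
  using assms by (subst laplace_expansion_row[of _ n k]) auto

lemma det_mat_swap:
  "det (mat n n (\<lambda>(i, j). f j i)) = (det (mat n n (\<lambda>(i, j). f i j)) :: 'a::comm_ring_1)"
  by (subst det_transpose[of _ n, symmetric]) (auto intro!: arg_cong[of _ _ det])

lemma det_scale_rows:
  "det (mat n n (\<lambda>(i, j). d i * f i j)) =
    (\<Prod>i<n. d i) * (det (mat n n (\<lambda>(i, j). f i j)) :: 'a::comm_ring_1)"
  using det_sum_rows[where b = "\<lambda>i. i" and I = "{..<n}" and n = n and K = "\<lambda>_. {()}" and c = d
      and f = "\<lambda>i _. f i"]
  by (simp add: bij_betw_def)

lemma det_scale_cols:
  "det (mat n n (\<lambda>(i, j). d j * f i j)) =
    (\<Prod>j<n. d j) * (det (mat n n (\<lambda>(i, j). f i j)) :: 'a::comm_ring_1)"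
  using det_scale_rows[of n d "\<lambda>i j. f j i"]
  by (simp add: det_mat_swap[of n "\<lambda>i j. d j * f i j"] det_mat_swap[of n f])

lemma det_sum_row:
  fixes f :: "'b \<Rightarrow> nat \<Rightarrow> 'a::comm_ring_1"
  assumes "k < n"
  shows "det (mat n n (\<lambda>(i, j). if i = k then \<Sum>h\<in>H. w h * f h j else g i j)) =
    (\<Sum>h\<in>H. w h * det (mat n n (\<lambda>(i, j). if i = k then f h j else g i j)))"
proof -
  \<comment> \<open>The cofactors along row \<open>k\<close> involve only the other rows, so they do
    not change with the content of row \<open>k\<close>.\<close>
  define C where "C j = (-1) ^ (k + j) * det (mat (n - 1) (n - 1) (\<lambda>(i', j').
    g (if i' < k then i' else Suc i') (if j' < j then j' else Suc j')))" for j
  have "det (mat n n (\<lambda>(i, j). if i = k then r j else g i j)) = (\<Sum>j<n. r j * C j)" for r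
  proof -
    have "mat_delete (mat n n (\<lambda>(i, j). if i = k then r j else g i j)) k j
        = mat (n - 1) (n - 1) (\<lambda>(i', j').
            g (if i' < k then i' else Suc i') (if j' < j then j' else Suc j'))" for j
      by (auto simp: mat_delete_def intro!: eq_matI)
    then show ?thesis
      using assms by (subst laplace_expansion_row[of _ n k]) (auto simp: cofactor_def C_def)
  qed
  then show ?thesis
    by (simp add: sum_distrib_right sum_distrib_left sum.swap[of _ H] ac_simps)
qed

text \<open>The matrix of \<open>g\<close> is a unit upper bidiagonal matrix times that of
  \<open>f\<close>. Each row receives a multiple of the next row of \<open>f\<close>, not of
  \<open>g\<close>, so all operations happen at once.\<close>

lemma det_eq_of_bidiagonal_rows:
  fixes f g :: "nat \<Rightarrow> nat \<Rightarrow> 'a::comm_ring_1"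
  assumes "\<And>i j. i < n \<Longrightarrow> j < n \<Longrightarrow> g i j = f i j + (if Suc i < n then s i * f (Suc i) j else 0)"
  shows "det (mat n n (\<lambda>(i, j). g i j)) = det (mat n n (\<lambda>(i, j). f i j))"
proof -
  let ?U = "mat n n (\<lambda>(i, j). if i = j then 1 else if j = Suc i then s i else 0)"
  have "(\<Sum>k = 0..<n. (if i = k then 1 else if k = Suc i then s i else 0) * f k j) = g i j"
    if "i < n" "j < n" for i j
  proof -
    have "(\<Sum>k = 0..<n. (if i = k then 1 else if k = Suc i then s i else 0) * f k j)
       = (\<Sum>k = 0..<n. (if k = i then f k j else 0) + (if k = Suc i then s i * f k j else 0))"
      by (intro sum.cong) auto
    also have "\<dots> = g i j"
      using that by (simp add: sum.distrib assms)
    finally show ?thesis .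
  qed
  then have "mat n n (\<lambda>(i, j). g i j) = ?U * mat n n (\<lambda>(i, j). f i j)"
    by (intro eq_matI) (auto simp: scalar_prod_def)
  moreover have "det ?U = 1"
  proof -
    have "upper_triangular ?U" by auto
    then have "det ?U = prod_list (diag_mat ?U)"
      by (rule det_upper_triangular[of _ n]) auto
    also have "diag_mat ?U = map (\<lambda>_. 1) [0..<n]"
      by (auto simp: diag_mat_def)
    finally show ?thesis by (simp add: prod.distinct_set_conv_list[symmetric])
  qed
  ultimately show ?thesis
    by (simp add: det_mult[of _ n])
qed

lemma det_eq_of_bidiagonal_cols:
  fixes f g :: "nat \<Rightarrow> nat \<Rightarrow> 'a::comm_ring_1"
  assumes "\<And>i j. i < n \<Longrightarrow> j < n \<Longrightarrow> g i j = f i j + (if Suc j < n then s j * f i (Suc j) else 0)"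
  shows "det (mat n n (\<lambda>(i, j). g i j)) = det (mat n n (\<lambda>(i, j). f i j))"
  using det_eq_of_bidiagonal_rows[of n "\<lambda>i j. g j i" "\<lambda>i j. f j i" s] assms
  by (simp add: det_mat_swap[of n g] det_mat_swap[of n f])

text \<open>Column \<open>j\<close> is a polynomial of degree \<open>n - 1 - j\<close> in
  \<open>x i\<close> with leading coefficient 1 or -1, so the constants \<open>c\<close> drop out
  and a Vandermonde determinant remains.\<close>

lemma det_prod_diff:
  fixes c x :: "nat \<Rightarrow> 'a::comm_ring_1"
  shows "det (mat n n (\<lambda>(i, j). \<Prod>k\<in>{j<..<n}. c k - x i)) = (\<Prod>j<n. \<Prod>i<j. x j - x i)"
proof (induction n arbitrary: c)
  case 0
  then show ?case by simp
next
  case (Suc m)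
  let ?p = "\<lambda>i j. \<Prod>k\<in>{j<..<Suc m}. c k - x i"
  let ?q = "\<lambda>i j. if j < m then (x m - x i) * ?p i (Suc j) else 1"
  let ?Q = "mat (Suc m) (Suc m) (\<lambda>(i, j). ?q i j)"
  have p: "?p i j = (c (Suc j) - x i) * ?p i (Suc j)" if "j < m" for i j
  proof -
    have "{j<..<Suc m} = insert (Suc j) {Suc j<..<Suc m}"
      using that by auto
    then show ?thesis by simp
  qed
  have "{m<..<Suc m} = {}" by auto
  \<comment> \<open>The multiplier is chosen to replace the factor \<open>c (Suc j) - x i\<close> by
    \<open>x m - x i\<close>, which clears the last row except for its final entry 1.\<close>
  then have "det (mat (Suc m) (Suc m) (\<lambda>(i, j). ?p i j)) = det ?Q"
    by (intro det_eq_of_bidiagonal_cols[where s = "\<lambda>j. x m - c (Suc j)", symmetric])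
      (auto simp: p less_Suc_eq algebra_simps)
  also have "\<dots> = cofactor ?Q m m"
    by (subst laplace_expansion_row[of _ "Suc m" m]) simp_all
  also have "\<dots> = det (mat_delete ?Q m m)"
    by (simp add: cofactor_def flip: power_mult_distrib power_add mult_2)
  also have "mat_delete ?Q m m
      = mat m m (\<lambda>(i, j). (x m - x i) * (\<Prod>k\<in>{j<..<m}. c (Suc k) - x i))"
  proof -
    \<comment> \<open>The constants are now shifted by one, which is why the induction keeps
      \<open>c\<close> arbitrary.\<close>
    have "?p i (Suc j) = (\<Prod>k\<in>{j<..<m}. c (Suc k) - x i)" for i j
      by (rule prod.reindex_bij_witness[of _ Suc "\<lambda>k. k - 1"]) auto
    then show ?thesis by (auto simp: mat_delete_def intro!: eq_matI)
  qed
  also have "det \<dots> = (\<Prod>i<m. x m - x i) * (\<Prod>j<m. \<Prod>i<j. x j - x i)"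
    by (simp add: det_scale_rows Suc.IH)
  finally show ?case by (simp add: mult.commute)
qed

section \<open>Ballot numbers\<close>

text \<open>The number of walks of \<open>T\<close> steps from the origin to height
  \<open>z\<close>; the value 0 at negative heights enforces the barrier.\<close>

primrec ballot :: "nat \<Rightarrow> int \<Rightarrow> 'a::comm_ring_1" where
  "ballot 0 z = (if z = 0 then 1 else 0)"
| "ballot (Suc T) z = (if z < 0 then 0 else ballot T (z - 1) + ballot T (z + 1))"

lemma ballot_neg: "z < 0 \<Longrightarrow> ballot T z = 0"
  by (cases T) auto

lemma ballot_eq_0: "z > int T \<Longrightarrow> ballot T z = 0"
  by (induction T arbitrary: z) auto

lemma ballot_diag: "ballot T (int T) = 1"
  by (induction T) (auto simp: ballot_eq_0)

text \<open>The convention for negative arguments respects the recurrence of the factorial: at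
  \<open>m = -1\<close> the factor \<open>m + 1\<close> vanishes, and below that both inverse
  factorials do.\<close>

lemma inv_fact_shift: "inv_fact m = of_int (m + 1) * (inv_fact (m + 1) :: 'a::field_char_0)"
proof (cases "m < 0")
  case True
  then show ?thesis by (cases "m = -1") (auto simp: inv_fact_def)
next
  case False
  then have "nat (m + 1) = Suc (nat m)" by simp
  then have "(fact (nat (m + 1)) :: 'a) = of_int (m + 1) * fact (nat m)"
    using False by simp
  moreover have "(of_int (m + 1) :: 'a) \<noteq> 0"
    using False by (simp only: of_int_eq_0_iff)
  ultimately show ?thesis using False by (simp add: inv_fact_def)
qed

text \<open>Admitting \<open>z = -1\<close>, where the factor \<open>z + 1\<close> vanishes, lets
  the induction step treat \<open>z = 0\<close> like every other height. For \<open>z > T\<close>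
  the last inverse factorial is 0.\<close>

lemma ballot_closed_form:
  assumes "z \<ge> -1" "even (int T - z)"
  shows "ballot T z = fact T * of_int (z + 1) * inv_fact ((int T + z) div 2 + 1)
    * (inv_fact ((int T - z) div 2) :: 'a::field_char_0)"
  using assms
proof (induction T arbitrary: z)
  case 0
  show ?case
  proof (cases "z = -1 \<or> z = 0")
    case True
    then show ?thesis using 0 by (auto simp: inv_fact_def)
  next
    case False
    then have "z \<ge> 1" using 0 by simp
    then show ?thesis using False by (simp add: inv_fact_def)
  qed
next
  case (Suc T)
  show ?case
  proof (cases "z = -1")
    case False
    then have z: "z \<ge> 0" using Suc.prems by simp
    obtain d where d: "int (Suc T) - z = 2 * d" using Suc.prems by (elim evenE)
    \<comment> \<open>For \<open>z \<le> T + 1\<close>, \<open>u\<close> and \<open>d\<close> are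
      the numbers of up and down steps of a walk of \<open>T + 1\<close> steps ending at
      \<open>z\<close>.\<close>
    define u where "u = d + z"
    have zu: "z = u - d" and T: "int T = u + d - 1" using d by (auto simp: u_def)
    have IH1: "ballot T (z - 1) = fact T * of_int z * inv_fact u * (inv_fact d :: 'a)"
    proof -
      have "even (int T - (z - 1))" using d by presburger
      moreover have "(int T + (z - 1)) div 2 + 1 = u" "(int T - (z - 1)) div 2 = d"
        using T zu by auto
      ultimately show ?thesis using Suc.IH[of "z - 1"] z by simp
    qed
    have IH2: "ballot T (z + 1) = fact T * of_int (z + 2) * inv_fact (u + 1) * (inv_fact (d - 1) :: 'a)"
    proof -
      have "even (int T - (z + 1))" using d by presburger
      moreover have "(int T + (z + 1)) div 2 + 1 = u + 1" "(int T - (z + 1)) div 2 = d - 1"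
        using T zu by auto
      ultimately show ?thesis using Suc.IH[of "z + 1"] z by (simp add: add.commute)
    qed
    have i1: "inv_fact u = of_int (u + 1) * (inv_fact (u + 1) :: 'a)"
      by (rule inv_fact_shift)
    have i2: "inv_fact (d - 1) = of_int d * (inv_fact d :: 'a)"
      using inv_fact_shift[of "d - 1"] by simp
    have fT: "(fact (Suc T) :: 'a) = of_int (u + d) * fact T"
    proof -
      have "u + d = int (Suc T)" using T by simp
      then show ?thesis by (simp only: of_int_of_nat_eq fact_Suc)
    qed
    have "ballot (Suc T) z = ballot T (z - 1) + (ballot T (z + 1) :: 'a)"
      using z by simp
    also have "\<dots> = fact T * inv_fact (u + 1) * inv_fact d * of_int (z * (u + 1) + (z + 2) * d)"
      unfolding IH1 IH2 i1 i2 by (simp add: algebra_simps)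
    \<comment> \<open>With \<open>z = u - d\<close> the numerator factors;
      \<open>u + d = T + 1\<close> then turns \<open>fact T\<close> into
      \<open>fact (Suc T)\<close>.\<close>
    also have "z * (u + 1) + (z + 2) * d = (u + d) * (z + 1)"
      by (simp add: zu algebra_simps)
    also have "fact T * inv_fact (u + 1) * inv_fact d * (of_int ((u + d) * (z + 1)) :: 'a)
        = fact (Suc T) * of_int (z + 1) * inv_fact (u + 1) * inv_fact d"
      unfolding fT by (simp add: ac_simps)
    also have "u + 1 = (int (Suc T) + z) div 2 + 1"
      using T zu by auto
    also have "d = (int (Suc T) - z) div 2"
      using d by simp
    finally show ?thesis .
  qed simp
qed

section \<open>The weighted count of a single walk\<close>

text \<open>Up to a factor \<open>\<kappa>\<close> this is the generating function of the walks of length \<open>T\<close> from the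
  origin to height \<open>z\<close>. Extending it by \<open>0\<close> to negative heights makes its recurrence uniform.\<close>

definition contact_ballot :: "'a::comm_ring_1 \<Rightarrow> nat \<Rightarrow> int \<Rightarrow> 'a" where
  "contact_ballot \<kappa> T z =
     (if z < 0 then 0 else \<Sum>h\<le>T. (\<kappa> - 1) ^ h * ballot T (z + 2 * int h))"

text \<open>Terms beyond \<open>h = T\<close> sit at heights above \<open>T\<close> and vanish, so
  sums for different \<open>T\<close> can share one range.\<close>

lemma contact_ballot_eq:
  assumes "z \<ge> 0" "T \<le> N"
  shows "contact_ballot \<kappa> T z = (\<Sum>h\<le>N. (\<kappa> - 1) ^ h * ballot T (z + 2 * int h))"
proof -
  have "\<forall>h\<in>{..N} - {..T}. (\<kappa> - 1) ^ h * ballot T (z + 2 * int h) = 0"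
    using assms(1) by (simp add: ballot_eq_0)
  then show ?thesis
    using assms by (simp add: contact_ballot_def sum.mono_neutral_left)
qed

lemma contact_ballot_neg: "z < 0 \<Longrightarrow> contact_ballot \<kappa> T z = 0"
  by (simp add: contact_ballot_def)

lemma contact_ballot_eq_0: "z > int T \<Longrightarrow> contact_ballot \<kappa> T z = 0"
  by (auto simp: contact_ballot_def ballot_eq_0)

lemma contact_ballot_rec:
  assumes "z \<ge> 0"
  shows "contact_ballot \<kappa> T z = ballot T z + (\<kappa> - 1) * contact_ballot \<kappa> T (z + 2)"
proof -
  have "contact_ballot \<kappa> T z = (\<Sum>h\<le>Suc T. (\<kappa> - 1) ^ h * ballot T (z + 2 * int h))"
    using assms by (intro contact_ballot_eq) auto
  also have "\<dots> = ballot T z + (\<kappa> - 1) * (\<Sum>h\<le>T. (\<kappa> - 1) ^ h * ballot T (z + 2 + 2 * int h))"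
    by (subst sum.atMost_Suc_shift) (simp add: sum_distrib_left algebra_simps)
  finally show ?thesis using assms by (simp add: contact_ballot_def)
qed

lemma contact_ballot_diag: "contact_ballot \<kappa> T (int T) = 1"
  using contact_ballot_rec[of "int T" \<kappa> T] by (simp add: ballot_diag contact_ballot_eq_0)

text \<open>Above the axis the ballot recurrence applies term by term. At height 0 the sum over
  heights \<open>2 * h - 1\<close> loses its term \<open>h = 0\<close>; reindexed, it is \<kappa> -
  1 times the sum over heights \<open>2 * h + 1\<close>, and together they give the factor
  \<kappa>.\<close>

lemma contact_ballot_step:
  assumes "z \<ge> 0"
  shows "contact_ballot \<kappa> (Suc T) z = (if z = 0 then \<kappa> else 1) *
    (\<Sum>e\<in>{1, -1}. contact_ballot \<kappa> T (z + e))"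
proof (cases "z = 0")
  case False
  then have "contact_ballot \<kappa> T (z + e)
      = (\<Sum>h\<le>Suc T. (\<kappa> - 1) ^ h * ballot T (z + e + 2 * int h))" if "e \<in> {1, -1}" for e
    using that assms by (intro contact_ballot_eq) auto
  moreover have "contact_ballot \<kappa> (Suc T) z = (\<Sum>h\<le>Suc T. (\<kappa> - 1) ^ h *
      (ballot T (z - 1 + 2 * int h) + ballot T (z + 1 + 2 * int h)))"
    using assms by (simp add: contact_ballot_def algebra_simps del: sum.atMost_Suc)
  ultimately show ?thesis
    using False by (simp add: distrib_left sum.distrib del: sum.atMost_Suc)
next
  case True
  have "contact_ballot \<kappa> (Suc T) 0
      = (\<Sum>h\<le>Suc T. (\<kappa> - 1) ^ h * ballot T (2 * int h - 1))
        + (\<Sum>h\<le>Suc T. (\<kappa> - 1) ^ h * ballot T (2 * int h + 1))"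
    by (simp add: contact_ballot_def distrib_left sum.distrib del: sum.atMost_Suc)
  also have "(\<Sum>h\<le>Suc T. (\<kappa> - 1) ^ h * ballot T (2 * int h - 1))
      = (\<kappa> - 1) * contact_ballot \<kappa> T 1"
    by (subst sum.atMost_Suc_shift)
      (simp add: contact_ballot_def ballot_neg sum_distrib_left algebra_simps)
  also have "(\<Sum>h\<le>Suc T. (\<kappa> - 1) ^ h * ballot T (2 * int h + 1)) = contact_ballot \<kappa> T 1"
    by (subst contact_ballot_eq[of 1 T "Suc T"]) (simp_all add: algebra_simps)
  finally show ?thesis
    using True by (simp add: contact_ballot_neg algebra_simps)
qed

section \<open>The determinant formula\<close>

lemma walks_same_time:
  "walks (t, x) (t, z) = (if x = z \<and> x \<ge> 0 then {[(t, x)]} else {})"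
proof -
  have "w = [(t, x)] \<and> x = z \<and> x \<ge> 0" if "w \<in> walks (t, x) (t, z)" for w
  proof -
    have "is_walk w" "hd w = (t, x)" "last w = (t, z)" using that by (auto simp: walks_def)
    moreover from this have "length w = 1" using is_walk_bounds[of w] by simp
    ultimately show ?thesis by (cases w) (auto simp: is_walk_def)
  qed
  then show ?thesis by (auto simp: walks_def is_walk_def)
qed

lemma det_contact_ballot_initial:
  "det (mat n n (\<lambda>(i, j). contact_ballot \<kappa> (2 * j) (2 * int i))) = (1 :: 'a::comm_ring_1)"
proof -
  let ?A = "mat n n (\<lambda>(i, j). contact_ballot \<kappa> (2 * j) (2 * int i))"
  have "upper_triangular ?A"
    by (auto simp: contact_ballot_eq_0)
  then have "det ?A = prod_list (diag_mat ?A)"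
    by (rule det_upper_triangular[of _ n]) auto
  also have "diag_mat ?A = map (\<lambda>_. 1) [0..<n]"
    using contact_ballot_diag[of \<kappa> "2 * i" for i] by (auto simp: diag_mat_def)
  finally show ?thesis by (simp add: prod.distinct_set_conv_list[symmetric])
qed

text \<open>Both sides satisfy the same recurrence in \<open>t\<close>. Configurations that violate strict monotonicity
  or positivity are included because the recurrence produces them; both sides vanish there.\<close>

lemma partition_fun_eq_det:
  fixes \<kappa> :: "'a::comm_ring_1"
  assumes "n \<ge> 1"
    and mono: "\<And>i. 1 \<le> i \<Longrightarrow> i < n \<Longrightarrow> Y i \<le> Y (Suc i)"
    and ge: "\<And>i. i \<in> {1..n} \<Longrightarrow> Y i \<ge> -1"
    and even: "\<And>i. i \<in> {1..n} \<Longrightarrow> even (int t - Y i)"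
  shows "partition_fun {1..n} (\<lambda>i. (0, 2 * int i - 2)) (int t) Y \<kappa> =
    \<kappa> * det (mat n n (\<lambda>(i, j). contact_ballot \<kappa> (t + 2 * j) (Y (Suc i))))"
  using mono ge even
proof (induction t arbitrary: Y)
  \<comment> \<open>A repeated height gives two equal rows and two walks with a common end; a
    negative height gives a zero row and admits no walk.\<close>
  have degenerate: "partition_fun {1..n} (\<lambda>i. (0, 2 * int i - 2)) (int t) Y \<kappa> =
      \<kappa> * det (mat n n (\<lambda>(i, j). contact_ballot \<kappa> (t + 2 * j) (Y (Suc i))))"
    if "\<not> inj_on Y {1..n} \<or> (\<exists>i\<in>{1..n}. Y i < 0)" for t Y
    using that
  proof
    assume inj: "\<not> inj_on Y {1..n}"
    then obtain i j where ij: "i \<in> {1..n}" "j \<in> {1..n}" "i \<noteq> j" "Y i = Y j"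
      by (auto simp: inj_on_def)
    define i' j' where "i' = i - 1" and "j' = j - 1"
    have ij': "i' < n" "j' < n" "i' \<noteq> j'" "Y (Suc i') = Y (Suc j')"
      using ij by (auto simp: i'_def j'_def)
    have "det (mat n n (\<lambda>(i, j). contact_ballot \<kappa> (t + 2 * j) (Y (Suc i)))) = 0"
      by (rule det_identical_rows[of _ n i' j']) (use ij' in auto)
    then show ?thesis
      using families_to_not_inj[OF inj] by (simp add: partition_fun_def)
  next
    assume "\<exists>i\<in>{1..n}. Y i < 0"
    then obtain i where i: "i \<in> {1..n}" "Y i < 0" by auto
    have "det (mat n n (\<lambda>(i, j). contact_ballot \<kappa> (t + 2 * j) (Y (Suc i)))) = 0"
      by (rule det_zero_row[of "i - 1"]) (use i in \<open>auto simp: contact_ballot_neg\<close>)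
    then show ?thesis
      using families_to_negative[of i "{1..n}" Y] i by (simp add: partition_fun_def)
  qed
  \<comment> \<open>Distinct heights of equal parity differ by at least 2, so moving each of them by
    1 preserves the weak order.\<close>
  have gap: "Y (Suc i) \<ge> Y i + 2"
    if "\<And>i. 1 \<le> i \<Longrightarrow> i < n \<Longrightarrow> Y i \<le> Y (Suc i)" "\<And>i. i \<in> {1..n} \<Longrightarrow> even (int t - Y i)"
      "inj_on Y {1..n}" "1 \<le> i" "i < n" for t i and Y :: "nat \<Rightarrow> int"
  proof -
    have "Y i \<noteq> Y (Suc i)" using inj_onD[OF that(3), of i "Suc i"] that(4,5) by auto
    moreover have "even (int t - Y i)" "even (int t - Y (Suc i))" using that by auto
    ultimately show ?thesis using that(1)[of i] that(4,5) by presburger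
  qed
  {
    case 0
    show ?case
    proof (cases "\<not> inj_on Y {1..n} \<or> (\<exists>i\<in>{1..n}. Y i < 0)")
      case False
      then have inj: "inj_on Y {1..n}" and Y0: "\<And>i. i \<in> {1..n} \<Longrightarrow> Y i \<ge> 0" by force+
      \<comment> \<open>Hence \<open>Y n \<ge> 2 * n - 2\<close>, with equality only for the packed
        heights \<open>2 * i - 2\<close>.\<close>
      have gap': "Y j - 2 * int j \<ge> Y i - 2 * int i" if "1 \<le> i" "i \<le> j" "j \<le> n" for i j
        using that(2,3)
      proof (induction j rule: dec_induct)
        case (step k)
        then show ?case using gap[OF 0(1,3) inj, of k] that(1) by simp
      qed simp
      have even1: "even (Y 1)" using 0(3)[of 1] assms(1) by simp
      show ?thesis
      proof (cases "Y n = 2 * int n - 2")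
        case True
        have Y_eq: "Y i = 2 * int i - 2" if "i \<in> {1..n}" for i
          using gap'[of i n] gap'[of 1 i] True Y0[of 1] that by auto
        let ?P = "\<lambda>i\<in>{1..n}. [(0 :: int, 2 * int i - 2)]"
        have "(\<Pi>\<^sub>E i\<in>{1..n}. walks (0, 2 * int i - 2) (0, Y i)) = (\<Pi>\<^sub>E i\<in>{1..n}. {?P i})"
          using Y_eq by (intro PiE_cong) (auto simp: walks_same_time)
        also have "\<dots> = {?P}"
          by (rule PiE_singleton[OF restrict_extensional])
        finally have "families_to {1..n} (\<lambda>i. (0, 2 * int i - 2)) 0 Y = {?P}"
          by (auto simp: families_to_def vicious_def)
        \<comment> \<open>The origin is the only contact of the family of one-point walks; it
          accounts for the prefactor \<kappa>.\<close>
        moreover have "{p. snd p = 0 \<and> (\<exists>i\<in>{1..n}. p \<in> set (?P i))} = {(0, 0)}"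
          using assms(1) by (auto intro!: bexI[of _ 1])
        then have "contacts {1..n} ?P = 1"
          by (simp add: contacts_def)
        moreover have "mat n n (\<lambda>(i, j). contact_ballot \<kappa> (0 + 2 * j) (Y (Suc i)))
            = mat n n (\<lambda>(i, j). contact_ballot \<kappa> (2 * j) (2 * int i))"
          using Y_eq by (intro eq_matI) auto
        ultimately show ?thesis
          by (simp add: partition_fun_def det_contact_ballot_initial)
      next
        case False
        \<comment> \<open>The largest time in the last row is \<open>2 * (n - 1)\<close>, too small
          to reach \<open>Y n\<close>, so this row is zero.\<close>
        have "Y n > 2 * int n - 2"
          using gap'[of 1 n] Y0[of 1] assms(1) False by auto
        then have "det (mat n n (\<lambda>(i, j). contact_ballot \<kappa> (0 + 2 * j) (Y (Suc i)))) = 0"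
          using assms(1) by (intro det_zero_row[of "n - 1"]) (auto intro!: contact_ballot_eq_0)
        moreover have "families_to {1..n} (\<lambda>i. (0, 2 * int i - 2)) 0 Y = {}"
          using False assms(1)
          by (auto simp: families_to_def PiE_eq_empty_iff walks_same_time intro!: bexI[of _ n]
              dest!: PiE_mem[of _ _ _ n])
        ultimately show ?thesis by (simp add: partition_fun_def)
      qed
    qed (rule degenerate)
  next
    case (Suc t)
    show ?case
    proof (cases "\<not> inj_on Y {1..n} \<or> (\<exists>i\<in>{1..n}. Y i < 0)")
      case False
      then have inj: "inj_on Y {1..n}" and Y0: "\<And>i. i \<in> {1..n} \<Longrightarrow> Y i \<ge> 0" by force+
      let ?E = "\<Pi>\<^sub>E i\<in>{1..n}. {1, -1 :: int}"
      let ?D = "\<lambda>e. det (mat n n (\<lambda>(i, j). contact_ballot \<kappa> (t + 2 * j) (Y (Suc i) + e (Suc i))))"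
      let ?c = "\<lambda>i. if Y i = 0 then \<kappa> else 1"
      have IH: "partition_fun {1..n} (\<lambda>i. (0, 2 * int i - 2)) (int t) (\<lambda>i. Y i + e i) \<kappa> = \<kappa> * ?D e"
        if "e \<in> ?E" for e
      proof (rule Suc.IH)
        have e: "e i = 1 \<or> e i = -1" if "i \<in> {1..n}" for i
          using PiE_mem[OF \<open>e \<in> ?E\<close> that] by auto
        show "Y i + e i \<le> Y (Suc i) + e (Suc i)" if "1 \<le> i" "i < n" for i
          using gap[OF Suc.prems(1,3) inj that] e[of i] e[of "Suc i"] that by auto
        show "Y i + e i \<ge> -1" if "i \<in> {1..n}" for i
          using Y0[OF that] e[OF that] by auto
        show "even (int t - (Y i + e i))" if "i \<in> {1..n}" for i
          using Suc.prems(3)[OF that] e[OF that] by auto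
      qed
      have "mat n n (\<lambda>(i, j). contact_ballot \<kappa> (Suc t + 2 * j) (Y (Suc i)))
          = mat n n (\<lambda>(i, j). ?c (Suc i) *
              (\<Sum>e\<in>{1, -1}. contact_ballot \<kappa> (t + 2 * j) (Y (Suc i) + e)))"
        using Y0 by (intro eq_matI) (auto simp: contact_ballot_step)
      moreover have "bij_betw Suc {..<n} {1..n}"
        by (rule bij_betw_byWitness[of _ "\<lambda>i. i - 1"]) auto
      ultimately have "det (mat n n (\<lambda>(i, j). contact_ballot \<kappa> (Suc t + 2 * j) (Y (Suc i))))
          = (\<Prod>i\<in>{1..n}. ?c i) * (\<Sum>e\<in>?E. ?D e)"
        using det_sum_rows[where b = Suc and I = "{1..n}" and K = "\<lambda>_. {1, -1 :: int}" and c = ?c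
            and f = "\<lambda>i e j. contact_ballot \<kappa> (t + 2 * j) (Y i + e)"]
        by (simp only: finite.intros)
      moreover have "(\<Prod>i\<in>{1..n}. ?c i) = \<kappa> ^ card {i\<in>{1..n}. Y i = 0}"
        by (simp add: prod.If_cases Int_def)
      moreover have "partition_fun {1..n} (\<lambda>i. (0, 2 * int i - 2)) (int t + 1) Y \<kappa>
          = \<kappa> ^ card {i\<in>{1..n}. Y i = 0} * (\<Sum>e\<in>?E. \<kappa> * ?D e)"
        using Y0 IH by (subst partition_fun_step[OF _ inj]) simp_all
      ultimately show ?thesis
        by (simp add: add.commute sum_distrib_left[symmetric] ac_simps)
    qed (rule degenerate)
  }
qed

section \<open>Evaluation of the determinant\<close>

text \<open>Lets every column share the inverse factorial of the last one, leaving a factor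
  polynomial in \<open>m\<close>.\<close>

lemma inv_fact_add:
  assumes "j < n"
  shows "inv_fact (m + int j) =
    inv_fact (m + int n - 1) * (\<Prod>k\<in>{j<..<n}. of_int (m + int k) :: 'a::field_char_0)"
proof -
  have "Suc j \<le> n" using assms by simp
  then show ?thesis
  proof (induction n rule: dec_induct)
    case base
    have "{j<..<Suc j} = {}" by auto
    then show ?case by simp
  next
    case (step k)
    have "{j<..<Suc k} = insert k {j<..<k}" using step by auto
    moreover have "inv_fact (m + int k - 1) = of_int (m + int k) * (inv_fact (m + int k) :: 'a)"
      using inv_fact_shift[of "m + int k - 1"] by simp
    ultimately show ?case using step by simp
  qed
qed

lemma det_ballot:
  fixes z :: "nat \<Rightarrow> int"
  assumes "\<And>i. i < n \<Longrightarrow> z i \<ge> 0" "\<And>i. i < n \<Longrightarrow> even (int t - z i)"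
  shows "det (mat n n (\<lambda>(i, j). ballot (t + 2 * j) (z i))) =
    (\<Prod>j<n. fact (t + 2 * j)) *
    (\<Prod>i<n. of_int (z i + 1) * inv_fact ((int t + z i) div 2 + int n)
       * inv_fact ((int t - z i) div 2 + int n - 1)) *
    (\<Prod>j<n. \<Prod>i<j. (of_int (z j + 1) / 2) ^ 2 - (of_int (z i + 1) / 2) ^ 2 :: 'a::field_char_0)"
proof -
  define x :: "nat \<Rightarrow> 'a" where "x i = (of_int (z i + 1) / 2) ^ 2" for i
  define c :: "nat \<Rightarrow> 'a" where "c k = (of_int (int t + 1 + 2 * int k) / 2) ^ 2" for k
  define r :: "nat \<Rightarrow> 'a" where "r i = of_int (z i + 1) * inv_fact ((int t + z i) div 2 + int n)
       * inv_fact ((int t - z i) div 2 + int n - 1)" for i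
  have "ballot (t + 2 * j) (z i) = fact (t + 2 * j) * (r i * (\<Prod>k\<in>{j<..<n}. c k - x i))"
    if ij: "i < n" "j < n" for i j
  proof -
    obtain d where d: "int t - z i = 2 * d" using assms(2)[OF ij(1)] by (elim evenE)
    define u where "u = d + z i"
    have t: "int t = u + d" and z: "z i = u - d" using d by (auto simp: u_def)
    have half: "(int t + z i) div 2 = u" "(int t - z i) div 2 = d" using t z by auto
    have half': "(int (t + 2 * j) + z i) div 2 + 1 = u + 1 + int j"
        "(int (t + 2 * j) - z i) div 2 = d + int j"
      using t z by auto
    \<comment> \<open>The two factors have sum \<open>t + 1 + 2 * k\<close> and difference
      \<open>z i + 1\<close>, so their product is a difference of squares; this explains
      \<open>c\<close> and \<open>x\<close>.\<close>
    have factor: "of_int (u + 1 + int k) * of_int (d + int k) = c k - x i" for k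
      by (simp add: c_def x_def t z power2_eq_square field_simps)
    have "even (int (t + 2 * j) - z i)" using assms(2)[OF ij(1)] by simp
    then have "ballot (t + 2 * j) (z i) = fact (t + 2 * j) * of_int (z i + 1)
        * inv_fact (u + 1 + int j) * (inv_fact (d + int j) :: 'a)"
      using ballot_closed_form[of "z i" "t + 2 * j"] assms(1)[OF ij(1)] unfolding half' by simp
    also have "\<dots> = fact (t + 2 * j) *
        (r i * (\<Prod>k\<in>{j<..<n}. of_int (u + 1 + int k) * of_int (d + int k)))"
      unfolding inv_fact_add[OF ij(2)] r_def half prod.distrib by (simp add: ac_simps)
    finally show ?thesis by (simp only: factor)
  qed
  then have "det (mat n n (\<lambda>(i, j). ballot (t + 2 * j) (z i)))
      = det (mat n n (\<lambda>(i, j). fact (t + 2 * j) * (r i * (\<Prod>k\<in>{j<..<n}. c k - x i))))"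
    by (intro arg_cong[of _ _ det] eq_matI) auto
  also have "\<dots> = (\<Prod>j<n. fact (t + 2 * j)) * (\<Prod>i<n. r i) * (\<Prod>j<n. \<Prod>i<j. x j - x i)"
    by (simp only: det_scale_cols det_scale_rows det_prod_diff mult.assoc)
  finally show ?thesis by (simp only: x_def r_def)
qed

lemma det_contact_ballot_eq_sum:
  fixes \<kappa> :: "'a::comm_ring_1"
  shows "det (mat (Suc m) (Suc m) (\<lambda>(i, j). contact_ballot \<kappa> (t + 2 * j) (int (y + 2 * i)))) =
    (\<Sum>h\<le>t + 2 * m. (\<kappa> - 1) ^ h * det (mat (Suc m) (Suc m)
       (\<lambda>(i, j). ballot (t + 2 * j) (int (y + 2 * i + (if i = m then 2 * h else 0))))))"
proof -
  let ?N = "{..t + 2 * m}"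
  let ?g = "\<lambda>i j. if i = m then \<Sum>h\<in>?N. (\<kappa> - 1) ^ h * ballot (t + 2 * j) (int (y + 2 * m + 2 * h))
      else ballot (t + 2 * j) (int (y + 2 * i))"
  have "det (mat (Suc m) (Suc m) (\<lambda>(i, j). contact_ballot \<kappa> (t + 2 * j) (int (y + 2 * i))))
      = det (mat (Suc m) (Suc m) (\<lambda>(i, j). ?g i j))"
  \<comment> \<open>\<open>contact_ballot_rec\<close>, solved for the ballot number, dictates the
    multiplier 1 - \<kappa>. The last row has no successor and keeps its whole sum.\<close>
  proof (rule det_eq_of_bidiagonal_rows[where s = "\<lambda>_. 1 - \<kappa>", symmetric])
    fix i j assume "i < Suc m" "j < Suc m"
    then show "?g i j = contact_ballot \<kappa> (t + 2 * j) (int (y + 2 * i))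
        + (if Suc i < Suc m then (1 - \<kappa>) * contact_ballot \<kappa> (t + 2 * j) (int (y + 2 * Suc i)) else 0)"
      using contact_ballot_eq[of "int (y + 2 * m)" "t + 2 * j" "t + 2 * m" \<kappa>]
        contact_ballot_rec[of "int (y + 2 * i)" \<kappa> "t + 2 * j"]
      by (auto simp: algebra_simps)
  qed
  also have "\<dots> = (\<Sum>h\<in>?N. (\<kappa> - 1) ^ h * det (mat (Suc m) (Suc m)
      (\<lambda>(i, j). if i = m then ballot (t + 2 * j) (int (y + 2 * m + 2 * h))
        else ballot (t + 2 * j) (int (y + 2 * i)))))"
    by (rule det_sum_row) simp
  also have "\<dots> = (\<Sum>h\<in>?N. (\<kappa> - 1) ^ h * det (mat (Suc m) (Suc m)
       (\<lambda>(i, j). ballot (t + 2 * j) (int (y + 2 * i + (if i = m then 2 * h else 0))))))"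
    by (intro sum.cong refl arg_cong2[of _ _ _ _ "(*)"] arg_cong[of _ _ det] eq_matI) auto
  finally show ?thesis .
qed

section \<open>Products of factorials and the packed end heights\<close>

lemma prod_add_eq_fact_divide:
  "(\<Prod>i<m. of_nat (a + 1 + i)) = (fact (a + m) / fact a :: 'a::field_char_0)"
proof (induction m)
  case (Suc m)
  have "fact (a + Suc m) = (of_nat (a + 1 + m) * fact (a + m) :: 'a)" by simp
  then show ?case by (simp only: prod.lessThan_Suc Suc.IH) (simp add: mult.commute)
qed simp

lemma prod_diff_eq_fact_divide:
  "(\<Prod>i<m. of_nat (m + h - i)) = (fact (m + h) / fact h :: 'a::field_char_0)"
proof -
  have "(\<Prod>i<m. of_nat (m + h - i) :: 'a) = (\<Prod>i<m. of_nat (h + 1 + (m - Suc i)))"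
    by (intro prod.cong) auto
  also have "\<dots> = (\<Prod>i<m. of_nat (h + 1 + i))"
    by (rule prod.nat_diff_reindex)
  also have "\<dots> = fact (m + h) / fact h"
    by (simp only: prod_add_eq_fact_divide add.commute[of m])
  finally show ?thesis .
qed

text \<open>The factor \<open>y + 2 * j + 1\<close> continues the run of the inner product, so
  factor \<open>j\<close> is \<open>fact (y + 2 * j + 1) / fact (y + j)\<close>. Splitting the
  product of \<open>fact (y + k)\<close> over \<open>k < 2 * m\<close> by parity of
  \<open>k\<close>, or into two halves, gives the right side.\<close>

lemma prod_odd_mult_prod_sums:
  "(\<Prod>j<m. of_nat (y + 2 * j + 1) * (\<Prod>i<j. of_nat (y + 1 + j + i))) =
    (\<Prod>j<m. fact (y + m + j) / fact (y + 2 * j) :: 'a::field_char_0)"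
proof (induction m)
  case (Suc m)
  \<comment> \<open>The window of factorials moves up by one: it loses \<open>fact (y + m)\<close>
    and gains \<open>fact (y + 2 * m)\<close> and \<open>fact (y + 2 * m + 1)\<close>.\<close>
  have "(\<Prod>j<Suc m. fact (y + Suc m + j)) * fact (y + m)
      = (\<Prod>j<Suc (Suc m). fact (y + m + j) :: 'a)"
    by (subst prod.lessThan_Suc_shift[of _ "Suc m"]) (simp add: ac_simps)
  also have "\<dots> = (\<Prod>j<m. fact (y + m + j)) * fact (y + 2 * m) * fact (y + 2 * m + 1)"
  proof -
    have "y + m + m = y + 2 * m" "y + m + Suc m = y + 2 * m + 1" by simp_all
    then show ?thesis by (simp only: prod.lessThan_Suc)
  qed
  finally have shift: "(\<Prod>j<Suc m. fact (y + Suc m + j)) =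
      (\<Prod>j<m. fact (y + m + j)) * fact (y + 2 * m) * (fact (y + 2 * m + 1) / fact (y + m) :: 'a)"
    by (simp add: field_simps del: fact_Suc)
  have "of_nat (y + 2 * m + 1) * (\<Prod>i<m. of_nat (y + 1 + m + i))
      = (\<Prod>i<Suc m. of_nat (y + m + 1 + i) :: 'a)"
  proof -
    have "y + 2 * m + 1 = y + m + 1 + m" "y + 1 + m = y + m + 1" by simp_all
    then show ?thesis by (simp only: prod.lessThan_Suc mult.commute)
  qed
  also have "\<dots> = fact (y + 2 * m + 1) / fact (y + m)"
  proof -
    have "y + m + Suc m = y + 2 * m + 1" by simp
    then show ?thesis by (simp only: prod_add_eq_fact_divide)
  qed
  finally have last: "of_nat (y + 2 * m + 1) * (\<Prod>i<m. of_nat (y + 1 + m + i))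
      = (fact (y + 2 * m + 1) / fact (y + m) :: 'a)" .
  have "(\<Prod>j<Suc m. of_nat (y + 2 * j + 1) * (\<Prod>i<j. of_nat (y + 1 + j + i)))
      = (\<Prod>j<m. fact (y + m + j)) / (\<Prod>j<m. fact (y + 2 * j)) * (fact (y + 2 * m + 1) / fact (y + m) :: 'a)"
    by (simp only: prod.lessThan_Suc Suc.IH last prod_dividef)
  also have "\<dots> = (\<Prod>j<Suc m. fact (y + Suc m + j)) / (\<Prod>j<Suc m. fact (y + 2 * j))"
    unfolding shift prod.lessThan_Suc[of "\<lambda>j. fact (y + 2 * j)"] by simp
  finally show ?case by (simp only: prod_dividef)
qed simp

text \<open>Here \<open>m\<close> is \<open>n - 1\<close>, and only the raised last row depends on
  \<open>h\<close>. Its Vandermonde factors with the other rows produce the binomial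
  coefficient.\<close>

lemma det_ballot_packed:
  assumes "even (int t - int y)"
  shows "det (mat (Suc m) (Suc m)
      (\<lambda>(i, j). ballot (t + 2 * j) (int (y + 2 * i + (if i = m then 2 * h else 0))))) =
    (\<Prod>j<Suc m. fact (t + 2 * j) * fact j) *
    (\<Prod>i<m. fact (y + m + i) / (fact (y + 2 * i) * fact ((t + y) div 2 + m + 1 + i))
       * inv_fact ((int t - int y) div 2 + int i + 1)) *
    (of_nat ((m + h) choose m) * (of_nat (y + 2 * m + 2 * h + 1) * fact (y + 2 * m + h)
       / (fact (y + m + h) * fact ((t + y) div 2 + 2 * m + h + 1)))
      * inv_fact ((int t - int y) div 2 - int h) :: 'a::field_char_0)"
proof -
  \<comment> \<open>\<open>d\<close> is negative when \<open>y > t\<close> and therefore stays an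
    integer under \<open>inv_fact\<close>; \<open>u\<close> is a natural number with ordinary
    factorials.\<close>
  define u d where "u = (t + y) div 2" and "d = (int t - int y) div 2"
  let ?z = "\<lambda>i. int (y + 2 * i + (if i = m then 2 * h else 0))"
  let ?w = "\<lambda>i. (of_int (?z i + 1) / 2) ^ 2 :: 'a"
  have ty: "int t + int y = 2 * int u" "int t - int y = 2 * d"
    using assms unfolding u_def d_def by presburger+
  have inv_fact_nat: "inv_fact (int k) = (1 / fact k :: 'a)" for k
    by (simp add: inv_fact_def)
  have diff: "?w j - ?w i = of_nat (j - i) * of_nat (y + 1 + j + i)" if "i < j" "j < m" for i j
    using that by (simp add: of_nat_diff power2_eq_square field_simps)
  have diff_last: "?w m - ?w i = of_nat (m + h - i) * of_nat (y + m + h + 1 + i)" if "i < m" for i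
    using that by (simp add: of_nat_diff power2_eq_square field_simps)
  \<comment> \<open>The argument \<open>d + m - i\<close> is written through
    \<open>m - Suc i\<close>, so that reversing the product turns it into
    \<open>d + i + 1\<close>.\<close>
  have row: "of_int (?z i + 1) * inv_fact ((int t + ?z i) div 2 + int (Suc m))
      * inv_fact ((int t - ?z i) div 2 + int (Suc m) - 1)
      = of_nat (y + 2 * i + 1) * (1 / fact (u + m + 1 + i)) * (inv_fact (d + int (m - Suc i) + 1) :: 'a)"
    if "i < m" for i
  proof -
    have "(int t + ?z i) div 2 + int (Suc m) = int (u + m + 1 + i)"
      "(int t - ?z i) div 2 + int (Suc m) - 1 = d + int (m - Suc i) + 1"
      using that ty by auto
    moreover have "?z i + 1 = int (y + 2 * i + 1)" using that by simp
    ultimately show ?thesis by (simp only: inv_fact_nat of_int_of_nat_eq)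
  qed
  have row_last: "of_int (?z m + 1) * inv_fact ((int t + ?z m) div 2 + int (Suc m))
      * inv_fact ((int t - ?z m) div 2 + int (Suc m) - 1)
      = of_nat (y + 2 * m + 2 * h + 1) * (1 / fact (u + 2 * m + h + 1)) * (inv_fact (d - int h) :: 'a)"
  proof -
    have "(int t + ?z m) div 2 + int (Suc m) = int (u + 2 * m + h + 1)"
      "(int t - ?z m) div 2 + int (Suc m) - 1 = d - int h"
      using ty by auto
    moreover have "?z m + 1 = int (y + 2 * m + 2 * h + 1)" by simp
    ultimately show ?thesis by (simp only: inv_fact_nat of_int_of_nat_eq)
  qed
  have fact_prod: "(\<Prod>i<j. of_nat (j - i)) = (fact j :: 'a)" for j
    using prod_diff_eq_fact_divide[of j 0, where 'a = 'a] by simp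
  have binomial: "(\<Prod>i<m. of_nat (m + h - i)) = (fact m * of_nat ((m + h) choose m) :: 'a)"
    unfolding prod_diff_eq_fact_divide by (simp add: binomial_fact)
  have vandermonde: "(\<Prod>j<Suc m. \<Prod>i<j. ?w j - ?w i) = (\<Prod>j<Suc m. fact j) *
      (\<Prod>j<m. \<Prod>i<j. of_nat (y + 1 + j + i)) *
      (of_nat ((m + h) choose m) * (fact (y + 2 * m + h) / fact (y + m + h) :: 'a))"
  proof -
    have "(\<Prod>j<m. \<Prod>i<j. ?w j - ?w i) = (\<Prod>j<m. fact j * (\<Prod>i<j. of_nat (y + 1 + j + i)))"
    proof (rule prod.cong[OF refl])
      fix j assume "j \<in> {..<m}"
      then have "(\<Prod>i<j. ?w j - ?w i) = (\<Prod>i<j. of_nat (j - i) * of_nat (y + 1 + j + i))"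
        by (intro prod.cong[OF refl] diff) auto
      then show "(\<Prod>i<j. ?w j - ?w i) = fact j * (\<Prod>i<j. of_nat (y + 1 + j + i))"
        by (simp only: prod.distrib fact_prod)
    qed
    moreover have "(\<Prod>i<m. ?w m - ?w i)
        = (\<Prod>i<m. of_nat (m + h - i) * of_nat (y + m + h + 1 + i))"
      by (intro prod.cong[OF refl] diff_last) auto
    moreover have "y + m + h + m = y + 2 * m + h" by simp
    ultimately show ?thesis
      by (simp only: prod.lessThan_Suc prod.distrib binomial prod_add_eq_fact_divide mult_ac)
  qed
  have rows: "(\<Prod>i<Suc m. of_int (?z i + 1) * inv_fact ((int t + ?z i) div 2 + int (Suc m))
      * inv_fact ((int t - ?z i) div 2 + int (Suc m) - 1))
      = (\<Prod>i<m. of_nat (y + 2 * i + 1) * (1 / fact (u + m + 1 + i))) *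
        (\<Prod>i<m. inv_fact (d + int i + 1)) *
        (of_nat (y + 2 * m + 2 * h + 1) * (1 / fact (u + 2 * m + h + 1)) * (inv_fact (d - int h) :: 'a))"
  proof -
    have "(\<Prod>i<m. of_int (?z i + 1) * inv_fact ((int t + ?z i) div 2 + int (Suc m))
        * inv_fact ((int t - ?z i) div 2 + int (Suc m) - 1))
      = (\<Prod>i<m. of_nat (y + 2 * i + 1) * (1 / fact (u + m + 1 + i))
        * (inv_fact (d + int (m - Suc i) + 1) :: 'a))"
      by (intro prod.cong[OF refl] row) auto
    also have "\<dots> = (\<Prod>i<m. of_nat (y + 2 * i + 1) * (1 / fact (u + m + 1 + i))) *
        (\<Prod>i<m. inv_fact (d + int i + 1))"
      unfolding prod.distrib[of _ "\<lambda>i. inv_fact (d + int (m - Suc i) + 1)"]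
      by (simp only: prod.nat_diff_reindex[of "\<lambda>i. inv_fact (d + int i + 1)"])
    finally show ?thesis by (simp only: prod.lessThan_Suc row_last)
  qed
  have sums: "(\<Prod>i<m. of_nat (y + 2 * i + 1)) * (\<Prod>j<m. \<Prod>i<j. of_nat (y + 1 + j + i))
      = (\<Prod>i<m. fact (y + m + i)) / (\<Prod>i<m. fact (y + 2 * i) :: 'a)"
    using prod_odd_mult_prod_sums[of y m, where 'a = 'a] by (simp only: prod.distrib prod_dividef)
  have "det (mat (Suc m) (Suc m) (\<lambda>(i, j). ballot (t + 2 * j) (?z i)))
      = (\<Prod>j<Suc m. fact (t + 2 * j)) *
        ((\<Prod>i<m. of_nat (y + 2 * i + 1) * (1 / fact (u + m + 1 + i))) *
        (\<Prod>i<m. inv_fact (d + int i + 1)) *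
        (of_nat (y + 2 * m + 2 * h + 1) * (1 / fact (u + 2 * m + h + 1)) * (inv_fact (d - int h) :: 'a))) *
        ((\<Prod>j<Suc m. fact j) * (\<Prod>j<m. \<Prod>i<j. of_nat (y + 1 + j + i)) *
        (of_nat ((m + h) choose m) * (fact (y + 2 * m + h) / fact (y + m + h))))"
    unfolding rows[symmetric] vandermonde[symmetric]
    using assms by (intro det_ballot) auto
  also have "\<dots> = ((\<Prod>j<Suc m. fact (t + 2 * j)) * (\<Prod>j<Suc m. fact j)) *
      (((\<Prod>i<m. of_nat (y + 2 * i + 1)) * (\<Prod>j<m. \<Prod>i<j. of_nat (y + 1 + j + i))) *
        (\<Prod>i<m. 1 / fact (u + m + 1 + i)) * (\<Prod>i<m. inv_fact (d + int i + 1))) *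
      (of_nat ((m + h) choose m) * (of_nat (y + 2 * m + 2 * h + 1) * fact (y + 2 * m + h)
       / (fact (y + m + h) * fact (u + 2 * m + h + 1))) * inv_fact (d - int h))"
    by (simp only: prod.distrib divide_inverse inverse_mult_distrib mult_1_left mult_ac)
  also have "\<dots> = (\<Prod>j<Suc m. fact (t + 2 * j) * fact j) *
    (\<Prod>i<m. fact (y + m + i) / (fact (y + 2 * i) * fact (u + m + 1 + i)) * inv_fact (d + int i + 1)) *
    (of_nat ((m + h) choose m) * (of_nat (y + 2 * m + 2 * h + 1) * fact (y + 2 * m + h)
       / (fact (y + m + h) * fact (u + 2 * m + h + 1))) * inv_fact (d - int h))"
    unfolding sums prod.distrib prod_dividef by simp
  finally show ?thesis unfolding u_def d_def .
qed

theorem theorem9: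
  fixes n t y :: nat and \<kappa> :: "'a::field_char_0"
  assumes "n \<ge> 1" and "t mod 2 = y mod 2"
  shows "Z n t y \<kappa> =
    (\<Prod>i<n. fact (t + 2 * i) * fact i)
    * (\<Prod>i<n - 1. fact (y + n + i - 1) / (fact (y + 2 * i) * fact ((t + y) div 2 + n + i))
         * inv_fact ((int t - int y) div 2 + int i + 1))
    * (\<Sum>h | int h \<le> (int t - int y) div 2.
         of_nat ((n + h - 1) choose (n - 1))
         * (of_nat (y + 2 * n + 2 * h - 1) * fact (y + 2 * n + h - 2)
            / (fact (y + n + h - 1) * fact ((t + y) div 2 + 2 * n + h - 1)))
         * inv_fact ((int t - int y) div 2 - int h)
         * (\<kappa> * (\<kappa> - 1) ^ h))"
proof -
  \<comment> \<open>With \<open>n = m + 1\<close> the truncated subtractions of the statement become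
    sums.\<close>
  obtain m where n: "n = Suc m" using assms(1) by (cases n) auto
  have even: "even (int t - int y)" using assms(2) by presburger
  define A :: 'a where "A = (\<Prod>j<Suc m. fact (t + 2 * j) * fact j) *
    (\<Prod>i<m. fact (y + m + i) / (fact (y + 2 * i) * fact ((t + y) div 2 + m + 1 + i))
       * inv_fact ((int t - int y) div 2 + int i + 1))"
  define B :: "nat \<Rightarrow> 'a" where "B h = of_nat ((m + h) choose m) *
      (of_nat (y + 2 * m + 2 * h + 1) * fact (y + 2 * m + h)
       / (fact (y + m + h) * fact ((t + y) div 2 + 2 * m + h + 1)))
      * inv_fact ((int t - int y) div 2 - int h)" for h
  let ?Y = "\<lambda>i. int y + 2 * int i - 2"
  have "Z n t y \<kappa> = partition_fun {1..n} (\<lambda>i. (0, 2 * int i - 2)) (int t) ?Y \<kappa>"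
    by (simp add: Z_def partition_fun_def families_def families_to_def)
  also have "\<dots> = \<kappa> * det (mat n n (\<lambda>(i, j). contact_ballot \<kappa> (t + 2 * j) (?Y (Suc i))))"
    using assms(1) even by (intro partition_fun_eq_det) auto
  also have "mat n n (\<lambda>(i, j). contact_ballot \<kappa> (t + 2 * j) (?Y (Suc i)))
      = mat (Suc m) (Suc m) (\<lambda>(i, j). contact_ballot \<kappa> (t + 2 * j) (int (y + 2 * i)))"
    unfolding n by (intro eq_matI) auto
  also have "\<kappa> * det \<dots> = A * (\<Sum>h\<le>t + 2 * m. B h * (\<kappa> * (\<kappa> - 1) ^ h))"
    unfolding det_contact_ballot_eq_sum det_ballot_packed[OF even] A_def[symmetric] B_def[symmetric]
    by (simp add: sum_distrib_left ac_simps)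
  also have "(\<Sum>h\<le>t + 2 * m. B h * (\<kappa> * (\<kappa> - 1) ^ h))
      = (\<Sum>h | int h \<le> (int t - int y) div 2. B h * (\<kappa> * (\<kappa> - 1) ^ h))"
  \<comment> \<open>Beyond \<open>(t - y) div 2\<close> the argument of \<open>inv_fact\<close> in
    \<open>B h\<close> is negative, so these terms vanish. If \<open>y > t\<close>, the right range
    is empty and every term on the left is 0.\<close>
  proof (rule sum.mono_neutral_right)
    show "\<forall>h\<in>{..t + 2 * m} - {h. int h \<le> (int t - int y) div 2}. B h * (\<kappa> * (\<kappa> - 1) ^ h) = 0"
      by (auto simp: B_def inv_fact_def)
  qed auto
  finally show ?thesis
    by (simp add: n A_def B_def add.assoc add.commute add.left_commute del: prod.lessThan_Suc fact_Suc)
qed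

end
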